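(* Let $U$ be the $n\times r$ eigenbasis matrix of the $r$ slowest modes (defined in the context), and for $T\subseteq\{1,\dots,n\}$ let $U(T)$ be the matrix consisting of the rows of $U$ indexed by $T$. The function $\phi(T)=\log\det(U(T)U(T)')$, where $U(T)'$ is the transpose of $U(T)$, is submodular in $T$.
   Context: A power system with $n$ generators has linearized dynamics $\Delta\ddot\delta=M^{-1}K\,\Delta\delta$. Here $\Delta\delta\in\mathbb{R}^n$ is the vector of rotor angle deviations of the generators and $M=\mathrm{diag}(2M_1/\omega_0,\dots,2M_n/\omega_0)$, with $M_i$ the inertia of generator $i$ and $\omega_0$ a base frequency. The $n\times n$ matrix $K$ has entries $K_{ij}=-V_iV_jB_{ij}\cos(\delta_i-\delta_j)$ for $i\ne j$ and $K_{ii}=-\sum_{k\ne i}K_{ik}$, where $V_i$ is the per unit voltage behind transient reactance at generator $i$, $\delta_i$ is its rotor angle, and $B_{ij}$ is the imaginary part of the $(i,j)$ entry of the admittance matrix reduced to the internal generator nodes. The $r$ slowest modes are the $r$ eigenvalues of $M^{-1}K$ with smallest magnitudes, and $U$ is an $n\times r$ basis matrix of the corresponding eigenspace; the rows of $U$ correspond to the generators. A set function $f:2^\Omega\to\mathbb{R}$ is submodular if, for any sets $S\subseteq T\subseteq\Omega$ and any $v\in\Omega\setminus T$, $f(S\cup\{v\})-f(S)\ge f(T\cup\{v\})-f(T)$.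
   Formalization: For |T|>r, or whenever the rows of U(T) are dependent, φ(T)=log 0 is not a real number; here log 0 is −∞ and submodularity is stated as φ(S∪{v})+φ(T) ≥ φ(T∪{v})+φ(S), which is the given inequality whenever φ(S) and φ(T) are finite. *)

theory Defs
  imports
    "HOL-Library.Extended_Real"
    "Jordan_Normal_Form.Char_Poly"
    "Jordan_Normal_Form.Gauss_Jordan_Elimination"
    "Jordan_Normal_Form.VS_Connect"
    "Jordan_Normal_Form.DL_Submatrix"
begin

text \<open>Generators are numbered \<open>0, \<dots>, n - 1\<close>.\<close>

definition inertia_mat :: "nat \<Rightarrow> real \<Rightarrow> (nat \<Rightarrow> real) \<Rightarrow> real mat" where
  "inertia_mat n \<omega>0 m = mat_diag n (\<lambda>i. 2 * m i / \<omega>0)"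

text \<open>\<open>Y\<close> is the admittance matrix reduced to the internal generator nodes.\<close>

definition coupling :: "(nat \<Rightarrow> real) \<Rightarrow> (nat \<Rightarrow> real) \<Rightarrow> complex mat \<Rightarrow> nat \<Rightarrow> nat \<Rightarrow> real" where
  "coupling V \<delta> Y i j = - (V i * V j * Im (Y $$ (i, j)) * cos (\<delta> i - \<delta> j))"

definition coupling_mat :: "nat \<Rightarrow> (nat \<Rightarrow> real) \<Rightarrow> (nat \<Rightarrow> real) \<Rightarrow> complex mat \<Rightarrow> real mat" where
  "coupling_mat n V \<delta> Y = mat n n (\<lambda>(i, j).
     if i = j then - (\<Sum>k \<in> {..<n} - {i}. coupling V \<delta> Y i k) else coupling V \<delta> Y i j)"

definition system_mat ::
    "nat \<Rightarrow> real \<Rightarrow> (nat \<Rightarrow> real) \<Rightarrow> (nat \<Rightarrow> real) \<Rightarrow> (nat \<Rightarrow> real) \<Rightarrow> complex mat \<Rightarrow> real mat" where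
  "system_mat n \<omega>0 m V \<delta> Y = the (mat_inverse (inertia_mat n \<omega>0 m)) * coupling_mat n V \<delta> Y"

text \<open>The inverse used in \<open>system_mat\<close> exists and is the expected diagonal matrix.\<close>

lemma mat_inverse_inertia_mat:
  assumes "\<omega>0 > 0" and "\<And>i. i < n \<Longrightarrow> m i > 0"
  shows "mat_inverse (inertia_mat n \<omega>0 m) = Some (mat_diag n (\<lambda>i. \<omega>0 / (2 * m i)))"
proof -
  let ?M = "inertia_mat n \<omega>0 m" and ?N = "mat_diag n (\<lambda>i. \<omega>0 / (2 * m i))"
  have M: "?M \<in> carrier_mat n n" by (simp add: inertia_mat_def)
  have N: "?N \<in> carrier_mat n n" by simp
  have eq: "mat_diag n f = 1\<^sub>m n" if "\<And>i. i < n \<Longrightarrow> f i = 1" for f :: "nat \<Rightarrow> real"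
    using that by (intro eq_matI) (auto simp: mat_diag_def)
  have MN: "?M * ?N = 1\<^sub>m n" and NM: "?N * ?M = 1\<^sub>m n"
    unfolding inertia_mat_def mat_diag_diag using assms
    by (force intro!: eq simp: field_simps)+
  have "?M \<in> Units (ring_mat TYPE(real) n ())"
    using M N MN NM by (auto simp: Units_def ring_mat_def)
  then obtain B where B: "mat_inverse ?M = Some B"
    using mat_inverse(1)[OF M, where b = "()"] by (cases "mat_inverse ?M") auto
  have "?M * B = 1\<^sub>m n" "B \<in> carrier_mat n n" using mat_inverse(2)[OF M B] by auto
  then have "B = ?N * ?M * B" using NM by simp
  also have "\<dots> = ?N * (?M * B)" by (rule assoc_mult_mat[OF N M \<open>B \<in> carrier_mat n n\<close>])
  also have "\<dots> = ?N" unfolding \<open>?M * B = 1\<^sub>m n\<close> by (rule right_mult_one_mat[OF N])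
  finally show ?thesis using B by simp
qed

text \<open>\<open>es\<close> lists all complex eigenvalues of \<open>A\<close>, repeated according to algebraic multiplicity, by
  increasing magnitude. The order within a group of equal magnitude is arbitrary.\<close>

definition spectrum_by_magnitude :: "real mat \<Rightarrow> complex list \<Rightarrow> bool" where
  "spectrum_by_magnitude A es \<longleftrightarrow>
     char_poly (map_mat complex_of_real A) = (\<Prod>e\<leftarrow>es. [:- e, 1:]) \<and>
     sorted_wrt (\<lambda>x y. cmod x \<le> cmod y) es"

definition basis_mat :: "nat \<Rightarrow> nat \<Rightarrow> complex vec set \<Rightarrow> complex mat \<Rightarrow> bool" where
  "basis_mat n r E W \<longleftrightarrow>
     W \<in> carrier_mat n r \<and> distinct (cols W) \<and>
     \<not> module.lin_dep class_ring (module_vec TYPE(complex) n) (set (cols W)) \<and>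
     vec_space.col_space n W = E"

text \<open>An eigenspace of the \<open>r\<close> slowest modes is spanned by \<open>r\<close> independent eigenvectors, one for each
  of the \<open>r\<close> smallest eigenvalues. Eigenvalues and eigenvectors are taken over the complex numbers
  because \<open>A\<close>, being a product with a matrix \<open>coupling_mat\<close> that need not be symmetric, may have
  nonreal ones.\<close>

definition slow_eigenspace :: "nat \<Rightarrow> nat \<Rightarrow> real mat \<Rightarrow> complex vec set \<Rightarrow> bool" where
  "slow_eigenspace n r A E \<longleftrightarrow> r \<le> n \<and>
     (\<exists>es W. spectrum_by_magnitude A es \<and> basis_mat n r E W \<and>
       (\<forall>k<r. eigenvector (map_mat complex_of_real A) (col W k) (es ! k)))"

text \<open>The columns of \<open>U\<close> need not be eigenvectors themselves.\<close>

definition slow_eigenbasis :: "nat \<Rightarrow> nat \<Rightarrow> real mat \<Rightarrow> real mat \<Rightarrow> bool" where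
  "slow_eigenbasis n r A U \<longleftrightarrow>
     (\<exists>E. slow_eigenspace n r A E \<and> basis_mat n r E (map_mat complex_of_real U))"

text \<open>Logarithm of a nonnegative real, with \<open>log 0 = - \<infinity>\<close> (whereas \<open>ln 0 = 0\<close> in the reals).
  Gram determinants are nonnegative, so the value at negative arguments is immaterial.\<close>

definition elog :: "real \<Rightarrow> ereal" where
  "elog x = (if x > 0 then ereal (ln x) else - \<infinity>)"

definition row_submat :: "real mat \<Rightarrow> nat set \<Rightarrow> real mat" where
  "row_submat U T = submatrix U T UNIV"

definition logdet_gram :: "real mat \<Rightarrow> nat set \<Rightarrow> ereal" where
  "logdet_gram U T = elog (det (row_submat U T * transpose_mat (row_submat U T)))"

text \<open>Submodularity for functions with values in \<open>[- \<infinity>, \<infinity>)\<close>. The inequality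
  \<open>f (S \<union> {v}) - f S \<ge> f (T \<union> {v}) - f T\<close> is written with sums because the difference
  \<open>- \<infinity> - (- \<infinity>)\<close> has no meaning (it is \<open>\<infinity>\<close> in type \<open>ereal\<close>). The two lemmas below recover
  the inequality between differences.\<close>

definition submodular_on :: "'a set \<Rightarrow> ('a set \<Rightarrow> ereal) \<Rightarrow> bool" where
  "submodular_on \<Omega> f \<longleftrightarrow>
     (\<forall>S T v. S \<subseteq> T \<longrightarrow> T \<subseteq> \<Omega> \<longrightarrow> v \<in> \<Omega> - T \<longrightarrow>
        f (S \<union> {v}) + f T \<ge> f (T \<union> {v}) + f S)"

lemma submodular_on_real_iff:
  fixes g :: "'a set \<Rightarrow> real"
  shows "submodular_on \<Omega> (\<lambda>A. ereal (g A)) \<longleftrightarrow>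
    (\<forall>S T v. S \<subseteq> T \<longrightarrow> T \<subseteq> \<Omega> \<longrightarrow> v \<in> \<Omega> - T \<longrightarrow> g (S \<union> {v}) - g S \<ge> g (T \<union> {v}) - g T)"
  unfolding submodular_on_def plus_ereal.simps ereal_less_eq by (simp add: algebra_simps)

lemma submodular_on_diff:
  assumes "submodular_on \<Omega> f" "S \<subseteq> T" "T \<subseteq> \<Omega>" "v \<in> \<Omega> - T" "\<bar>f S\<bar> \<noteq> \<infinity>" "\<bar>f T\<bar> \<noteq> \<infinity>"
  shows "f (S \<union> {v}) - f S \<ge> f (T \<union> {v}) - f T"
proof -
  have "f (T \<union> {v}) + f S \<le> f (S \<union> {v}) + f T"
    using assms(1-4) unfolding submodular_on_def by blast
  with assms(5,6) show ?thesis
    by (cases "f S"; cases "f T"; cases "f (S \<union> {v})"; cases "f (T \<union> {v})") auto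
qed

end

theory Submission
  imports Defs
begin

text \<open>
  Inserting the row \<open>v\<close> into \<open>T\<close> multiplies the Gram determinant by the squared distance from row
  \<open>v\<close> to the span of the rows in \<open>T\<close>. That distance decreases when \<open>T\<close> grows, which is
  submodularity of the logarithm.
\<close>

definition principal_minor :: "(nat \<Rightarrow> nat \<Rightarrow> 'a) \<Rightarrow> nat set \<Rightarrow> 'a::idom" where
  "principal_minor K T = det (mat (card T) (card T) (\<lambda>(i, j). K (pick T i) (pick T j)))"

lemma bij_betw_pick:
  assumes "finite T"
  shows "bij_betw (pick T) {..<card T} T"
proof -
  have inj: "inj_on (pick T) {..<card T}"
  proof (rule inj_onI)
    fix i j assume "i \<in> {..<card T}" "j \<in> {..<card T}" "pick T i = pick T j"
    then show "i = j"
      by (metis card_pick_le lessThan_iff)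
  qed
  have "pick T ` {..<card T} \<subseteq> T"
    using pick_in_set_le by auto
  then have "pick T ` {..<card T} = T"
    by (rule card_subset_eq[OF assms]) (simp add: card_image[OF inj])
  with inj show ?thesis by (simp add: bij_betw_def)
qed

lemma det_permute_rows_cols:
  fixes A :: "'a::idom mat"
  assumes A: "A \<in> carrier_mat k k" and p: "p permutes {0..<k}"
  shows "det (mat k k (\<lambda>(i, j). A $$ (p i, p j))) = det A"
proof -
  define B where "B = mat k k (\<lambda>(i, j). A $$ (p i, j))"
  have B: "B \<in> carrier_mat k k" "B\<^sup>T \<in> carrier_mat k k" by (auto simp: B_def)
  have p_less: "p i < k" if "i < k" for i
    using permutes_in_image[OF p, of i] that by auto
  have "mat k k (\<lambda>(i, j). A $$ (p i, p j)) = (mat k k (\<lambda>(i, j). B\<^sup>T $$ (p i, j)))\<^sup>T"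
    by (rule eq_matI) (auto simp: B_def p_less)
  then have "det (mat k k (\<lambda>(i, j). A $$ (p i, p j))) = det (mat k k (\<lambda>(i, j). B\<^sup>T $$ (p i, j)))"
    using det_transpose[of "mat k k (\<lambda>(i, j). B\<^sup>T $$ (p i, j))" k] by simp
  also have "\<dots> = signof p * det B"
    by (simp add: det_permute_rows[OF B(2) p] det_transpose[OF B(1)])
  also have "\<dots> = (signof p * signof p) * det A"
    by (simp add: B_def det_permute_rows[OF A p])
  also have "\<dots> = det A" by (simp add: sign_def)
  finally show ?thesis .
qed

lemma principal_minor_enum:
  fixes K :: "nat \<Rightarrow> nat \<Rightarrow> 'a::idom"
  assumes f: "bij_betw f {..<k} T"
  shows "principal_minor K T = det (mat k k (\<lambda>(i, j). K (f i) (f j)))"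
proof -
  have fin: "finite T" and k: "card T = k"
    using bij_betw_finite[OF f] bij_betw_same_card[OF f] by auto
  define g where "g = inv_into {..<k} f"
  define p where "p i = (if i \<in> {0..<k} then g (pick T i) else i)" for i
  have "bij_betw (g \<circ> pick T) {..<k} {..<k}"
    using bij_betw_trans[OF bij_betw_pick[OF fin] bij_betw_inv_into[OF f, folded g_def]] k by simp
  then have "bij_betw p {0..<k} {0..<k}"
    by (subst bij_betw_cong[of _ _ "g \<circ> pick T"]) (auto simp: p_def lessThan_atLeast0)
  then have p: "p permutes {0..<k}"
    by (rule bij_imp_permutes) (simp add: p_def)
  have fp: "f (p i) = pick T i" if "i < k" for i
    using that k f pick_in_set_le[of i T] by (auto simp: p_def g_def bij_betw_def f_inv_into_f)
  have p_less: "p i < k" if "i < k" for i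
    using permutes_in_image[OF p, of i] that by auto
  let ?A = "mat k k (\<lambda>(i, j). K (f i) (f j))"
  have "mat k k (\<lambda>(i, j). K (pick T i) (pick T j)) = mat k k (\<lambda>(i, j). ?A $$ (p i, p j))"
    by (rule eq_matI) (auto simp: fp p_less)
  with det_permute_rows_cols[OF _ p, of ?A] show ?thesis
    by (simp add: principal_minor_def k)
qed

lemma principal_minor_insert:
  fixes K :: "nat \<Rightarrow> nat \<Rightarrow> 'a::idom"
  assumes fin: "finite T" and v: "v \<notin> T"
    and lin: "\<And>j. j \<in> T \<Longrightarrow> K v j = (\<Sum>i\<in>T. c i * K i j)"
  shows "principal_minor K (insert v T) = principal_minor K T * (K v v - (\<Sum>i\<in>T. c i * K i v))"
proof -
  define k where "k = card T"
  define f where "f i = (if i < k then pick T i else v)" for i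
  have f: "bij_betw f {..<k} T"
    using bij_betw_pick[OF fin] by (subst bij_betw_cong[of _ _ "pick T"]) (auto simp: f_def k_def)
  have fk: "f k = v" by (simp add: f_def)
  have f': "bij_betw f {..<Suc k} (insert v T)"
    using notIn_Un_bij_betw[of k "{..<k}" f T] f v by (simp add: fk lessThan_Suc)
  have sum_T: "(\<Sum>i\<in>T. h i) = (\<Sum>i<k. h (f i))" for h :: "nat \<Rightarrow> 'a"
    using sum.reindex_bij_betw[OF f, of h] by simp
  let ?A = "mat (Suc k) (Suc k) (\<lambda>(i, j). K (f i) (f j))"
  let ?G = "mat k k (\<lambda>(i, j). K (f i) (f j))"
  let ?d = "K v v - (\<Sum>i\<in>T. c i * K i v)"
  define L where "L = mat (Suc k) (Suc k)
    (\<lambda>(i, j). if i = j then 1 else if i = k then - c (f j) else 0)"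
  define B where "B = four_block_mat ?G (mat k 1 (\<lambda>(i, _). K (f i) v)) (0\<^sub>m 1 k) (mat 1 1 (\<lambda>_. ?d))"
  have LA: "L * ?A = B"
  proof (rule eq_matI)
    fix i j assume "i < dim_row B" "j < dim_col B"
    then have i: "i < Suc k" and j: "j < Suc k" by (auto simp: B_def)
    have "(L * ?A) $$ (i, j) = (\<Sum>l<Suc k. L $$ (i, l) * K (f l) (f j))"
      using i j by (simp add: L_def scalar_prod_def lessThan_atLeast0 del: sum.lessThan_Suc sum.op_ivl_Suc)
    also have "\<dots> = B $$ (i, j)"
    proof (cases "i = k")
      case True
      have "(\<Sum>l<Suc k. L $$ (i, l) * K (f l) (f j)) = K v (f j) - (\<Sum>l\<in>T. c l * K l (f j))"
        unfolding sum_T using True by (simp add: L_def fk sum_negf)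
      also have "\<dots> = B $$ (i, j)"
      proof (cases "j = k")
        case False
        then have "f j \<in> T" using bij_betwE[OF f] j by auto
        then show ?thesis using False True j lin by (simp add: B_def)
      qed (simp add: True B_def fk)
      finally show ?thesis .
    next
      case False
      have "(\<Sum>l<Suc k. L $$ (i, l) * K (f l) (f j)) = (\<Sum>l<Suc k. if l = i then K (f i) (f j) else 0)"
        using False i by (intro sum.cong) (auto simp: L_def)
      also have "\<dots> = K (f i) (f j)" using i by (simp del: sum.lessThan_Suc)
      also have "\<dots> = B $$ (i, j)" using False i j by (auto simp: B_def less_Suc_eq fk)
      finally show ?thesis .
    qed
    finally show "(L * ?A) $$ (i, j) = B $$ (i, j)" .
  qed (auto simp: L_def B_def)
  have "det L = prod_list (diag_mat L)"
    by (rule det_lower_triangular[of "Suc k"]) (auto simp: L_def)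
  also have "diag_mat L = map (\<lambda>_. 1) [0..<Suc k]"
    unfolding diag_mat_def by (rule map_cong) (auto simp: L_def)
  finally have "det L = 1" by (simp add: map_replicate_const prod_list_replicate del: upt_Suc)
  then have "det ?A = det B"
    using det_mult[of L "Suc k" ?A] LA by (simp add: L_def)
  also have "\<dots> = det ?G * ?d"
    unfolding B_def by (subst det_four_block_mat_lower_left_zero[where n = k and m = 1]) (auto simp: det_single)
  finally show ?thesis
    by (simp add: principal_minor_enum[OF f] principal_minor_enum[OF f'])
qed

definition dot :: "nat \<Rightarrow> (nat \<Rightarrow> real) \<Rightarrow> (nat \<Rightarrow> real) \<Rightarrow> real" where
  "dot r f g = (\<Sum>k<r. f k * g k)"

lemma dot_commute: "dot r f g = dot r g f"
  by (simp add: dot_def mult.commute)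

lemma dot_lincomb_left:
  "dot r (\<lambda>k. f k + a * g k) h = dot r f h + a * dot r g h"
  by (simp add: dot_def sum.distrib sum_distrib_left algebra_simps)

lemma dot_sum_left:
  "dot r (\<lambda>k. \<Sum>j\<in>T. c j * x j k) h = (\<Sum>j\<in>T. c j * dot r (x j) h)"
  unfolding dot_def by (simp add: sum_distrib_left sum_distrib_right mult.assoc, rule sum.swap)

lemma dot_self_nonneg: "dot r f f \<ge> 0"
  by (simp add: dot_def sum_nonneg)

lemma dot_eq_0_if_self:
  assumes "dot r f f = 0" shows "dot r f g = 0"
proof -
  have "f k = 0" if "k < r" for k
    using assms that unfolding dot_def by (subst (asm) sum_nonneg_eq_0_iff) auto
  then show ?thesis by (simp add: dot_def)
qed

definition residual :: "(nat \<Rightarrow> nat \<Rightarrow> real) \<Rightarrow> nat set \<Rightarrow> (nat \<Rightarrow> real) \<Rightarrow> (nat \<Rightarrow> real) \<Rightarrow> nat \<Rightarrow> real" where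
  "residual x T c v k = v k - (\<Sum>j\<in>T. c j * x j k)"

lemma dot_residual:
  "dot r (residual x T c v) h = dot r v h - (\<Sum>j\<in>T. c j * dot r (x j) h)"
  unfolding dot_sum_left[symmetric] residual_def
  by (simp add: dot_def sum_subtractf left_diff_distrib)

lemma orthogonal_residual_exists:
  assumes "finite T"
  shows "\<exists>c. \<forall>i\<in>T. dot r (residual x T c v) (x i) = 0"
  using assms
proof (induction T arbitrary: v)
  case (insert a T)
  obtain c where c: "\<And>i. i \<in> T \<Longrightarrow> dot r (residual x T c v) (x i) = 0"
    using insert.IH by blast
  obtain d where d: "\<And>i. i \<in> T \<Longrightarrow> dot r (residual x T d (x a)) (x i) = 0"
    using insert.IH by blast
  let ?p = "residual x T c v" and ?q = "residual x T d (x a)"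
  have orth_a: "dot r p (x a) = dot r p ?q" if "\<And>i. i \<in> T \<Longrightarrow> dot r p (x i) = 0" for p
    using dot_residual[of r x T d "x a" p] that by (simp add: dot_commute[of r _ p])
  \<comment> \<open>The quotient is \<open>0\<close> if \<open>?q\<close> vanishes, that is, if \<open>x a\<close> already lies in the span of \<open>T\<close>.\<close>
  define t where "t = dot r ?p ?q / dot r ?q ?q"
  define c' where "c' j = (if j = a then t else c j - t * d j)" for j
  have "residual x (insert a T) c' v = (\<lambda>k. ?p k + (- t) * ?q k)"
  proof
    fix k
    have "(\<Sum>j\<in>T. c' j * x j k) = (\<Sum>j\<in>T. c j * x j k - t * (d j * x j k))"
      using insert.hyps by (intro sum.cong) (auto simp: c'_def algebra_simps)
    also have "\<dots> = (\<Sum>j\<in>T. c j * x j k) - t * (\<Sum>j\<in>T. d j * x j k)"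
      by (simp add: sum_subtractf sum_distrib_left)
    finally have "(\<Sum>j\<in>insert a T. c' j * x j k) =
        t * x a k + ((\<Sum>j\<in>T. c j * x j k) - t * (\<Sum>j\<in>T. d j * x j k))"
      using insert.hyps by (simp add: c'_def)
    then show "residual x (insert a T) c' v k = ?p k + (- t) * ?q k"
      unfolding residual_def by (simp add: right_diff_distrib)
  qed
  then have res: "dot r (residual x (insert a T) c' v) h = dot r ?p h - t * dot r ?q h" for h
    using dot_lincomb_left[of r ?p "- t" ?q h] by simp
  have T0: "dot r (residual x (insert a T) c' v) (x i) = 0" if "i \<in> T" for i
    using that c d by (simp add: res)
  have "dot r ?p ?q - t * dot r ?q ?q = 0"
    using dot_eq_0_if_self[of r ?q ?p] by (auto simp: t_def dot_commute[of r ?p])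
  then have "dot r (residual x (insert a T) c' v) (x a) = 0"
    using orth_a[OF T0] res[of ?q] by simp
  with T0 show ?case by (intro exI[of _ c']) simp
qed simp

lemma dot_residual_orthogonal:
  assumes "\<And>i. i \<in> T \<Longrightarrow> dot r p (x i) = 0"
  shows "dot r p (residual x T c v) = dot r p v"
  using dot_residual[of r x T c v p] assms by (simp add: dot_commute[of r _ p])

lemma gram_minor_insert:
  assumes "finite T" "v \<notin> T"
    and orth: "\<And>i. i \<in> T \<Longrightarrow> dot r (residual x T c (x v)) (x i) = 0"
  shows "principal_minor (\<lambda>i j. dot r (x i) (x j)) (insert v T) =
    principal_minor (\<lambda>i j. dot r (x i) (x j)) T *
    dot r (residual x T c (x v)) (residual x T c (x v))"
proof -
  have "dot r (x v) (x j) = (\<Sum>i\<in>T. c i * dot r (x i) (x j))" if "j \<in> T" for j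
    using orth[OF that] by (simp add: dot_residual)
  then show ?thesis
    using principal_minor_insert[OF assms(1,2), of "\<lambda>i j. dot r (x i) (x j)" c]
    by (simp add: dot_residual_orthogonal[OF orth] dot_residual[of _ _ _ _ _ "x v"])
qed

lemma gram_minor_nonneg:
  assumes "finite T"
  shows "principal_minor (\<lambda>i j. dot r (x i) (x j)) T \<ge> 0"
  using assms
proof (induction T)
  case empty
  then show ?case by (simp add: principal_minor_def)
next
  case (insert v T)
  obtain c where "\<And>i. i \<in> T \<Longrightarrow> dot r (residual x T c (x v)) (x i) = 0"
    using orthogonal_residual_exists[OF insert.hyps(1)] by blast
  then show ?case
    using gram_minor_insert[OF insert.hyps, of r x c] insert.IH by (simp add: dot_self_nonneg)
qed

lemma residual_antimono:
  assumes "S \<subseteq> T" "finite T"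
    and orth: "\<And>i. i \<in> T \<Longrightarrow> dot r (residual x T c v) (x i) = 0"
  shows "dot r (residual x T c v) (residual x T c v) \<le> dot r (residual x S d v) (residual x S d v)"
proof -
  let ?p = "residual x T c v" and ?q = "residual x S d v"
  define w where "w k = ?q k + (- 1) * ?p k" for k
  have pq: "dot r ?p ?q = dot r ?p ?p"
    using assms by (subst (1 2) dot_residual_orthogonal) auto
  have w: "dot r w h = dot r ?q h - dot r ?p h" for h
    unfolding w_def[abs_def] dot_lincomb_left by simp
  have "dot r w w = dot r ?q ?q - dot r ?p ?p"
    using w[of w] w[of ?p] w[of ?q] pq
      dot_commute[of r w ?q] dot_commute[of r w ?p] dot_commute[of r ?q ?p] by linarith
  with dot_self_nonneg[of r w] show ?thesis by simp
qed

lemma gram_minor_submodular: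
  fixes x :: "nat \<Rightarrow> nat \<Rightarrow> real" and r :: nat
  defines "D \<equiv> principal_minor (\<lambda>i j. dot r (x i) (x j))"
  assumes "S \<subseteq> T" "finite T" "v \<notin> T"
  shows "D (insert v T) * D S \<le> D (insert v S) * D T"
proof -
  have S: "finite S" "v \<notin> S" using assms finite_subset by auto
  obtain c where c: "\<And>i. i \<in> T \<Longrightarrow> dot r (residual x T c (x v)) (x i) = 0"
    using orthogonal_residual_exists[OF assms(3)] by blast
  obtain d where d: "\<And>i. i \<in> S \<Longrightarrow> dot r (residual x S d (x v)) (x i) = 0"
    using orthogonal_residual_exists[OF S(1)] by blast
  let ?p = "residual x T c (x v)" and ?q = "residual x S d (x v)"
  have "D (insert v T) * D S = (D T * D S) * dot r ?p ?p"
    unfolding D_def by (subst gram_minor_insert[OF assms(3,4) c]) (simp_all add: mult_ac)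
  also have "\<dots> \<le> (D T * D S) * dot r ?q ?q"
    unfolding D_def using assms S
    by (intro mult_left_mono residual_antimono c mult_nonneg_nonneg gram_minor_nonneg) auto
  also have "\<dots> = D (insert v S) * D T"
    unfolding D_def by (subst gram_minor_insert[OF S d]) (simp_all add: mult_ac)
  finally show ?thesis .
qed

lemma det_row_submat_gram:
  assumes U: "U \<in> carrier_mat n r" and T: "T \<subseteq> {..<n}"
  shows "det (row_submat U T * (row_submat U T)\<^sup>T) =
    principal_minor (\<lambda>i j. dot r (\<lambda>k. U $$ (i, k)) (\<lambda>k. U $$ (j, k))) T"
proof -
  have "{i. i < n \<and> i \<in> T} = T" using T by auto
  then have "row_submat U T = mat (card T) r (\<lambda>(i, k). U $$ (pick T i, k))"
    using U by (simp add: row_submat_def submatrix_def pick_UNIV)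
  then have "row_submat U T * (row_submat U T)\<^sup>T = mat (card T) (card T)
      (\<lambda>(i, j). dot r (\<lambda>k. U $$ (pick T i, k)) (\<lambda>k. U $$ (pick T j, k)))"
    by (intro eq_matI) (auto simp: scalar_prod_def dot_def lessThan_atLeast0)
  then show ?thesis by (simp add: principal_minor_def)
qed

lemma elog_mult_mono:
  assumes "a * b \<le> c * d" "a \<ge> 0" "b \<ge> 0" "c \<ge> 0" "d \<ge> 0"
  shows "elog a + elog b \<le> elog c + elog d"
proof (cases "a > 0 \<and> b > 0")
  case True
  then have "0 < c * d" using assms(1) by (meson less_le_trans mult_pos_pos)
  then have "c > 0" "d > 0" using assms(4,5) by (auto simp: zero_less_mult_iff)
  moreover have "ln (a * b) \<le> ln (c * d)"
    using True assms(1) by (intro ln_mono) auto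
  ultimately show ?thesis using True by (simp add: elog_def ln_mult)
next
  case False
  then show ?thesis by (auto simp: elog_def)
qed

lemma submodular_on_logdet_gram:
  assumes U: "U \<in> carrier_mat n r"
  shows "submodular_on {..<n} (logdet_gram U)"
  unfolding submodular_on_def
proof (intro allI impI)
  fix S T v assume ST: "S \<subseteq> T" and T: "T \<subseteq> {..<n}" and v: "v \<in> {..<n} - T"
  have fin: "finite T" using T finite_subset by blast
  have finS: "finite S" using ST fin finite_subset by blast
  let ?D = "principal_minor (\<lambda>i j. dot r (\<lambda>k. U $$ (i, k)) (\<lambda>k. U $$ (j, k)))"
  have D: "logdet_gram U A = elog (?D A)" if "A \<subseteq> {..<n}" for A
    using det_row_submat_gram[OF U that] by (simp add: logdet_gram_def)
  have "elog (?D (insert v T)) + elog (?D S) \<le> elog (?D (insert v S)) + elog (?D T)"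
    using ST fin finS v by (intro elog_mult_mono gram_minor_submodular gram_minor_nonneg) auto
  then show "logdet_gram U (T \<union> {v}) + logdet_gram U S \<le> logdet_gram U (S \<union> {v}) + logdet_gram U T"
    using ST T v by (simp add: D subset_trans[OF ST])
qed

theorem theorem2:
  fixes n r :: nat
    and \<omega>0 :: real
    and m V \<delta> :: "nat \<Rightarrow> real"
    and Y :: "complex mat"
    and U :: "real mat"
  assumes "\<omega>0 > 0"
    and "\<And>i. i < n \<Longrightarrow> m i > 0"
    and "Y \<in> carrier_mat n n"
    and "slow_eigenbasis n r (system_mat n \<omega>0 m V \<delta> Y) U"
  shows "submodular_on {..<n} (logdet_gram U)"
proof -
  obtain E where "basis_mat n r E (map_mat complex_of_real U)"
    using assms(4) unfolding slow_eigenbasis_def by blast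
  then have "map_mat complex_of_real U \<in> carrier_mat n r"
    unfolding basis_mat_def by (rule conjunct1)
  then have "U \<in> carrier_mat n r" by simp
  then show ?thesis by (rule submodular_on_logdet_gram)
qed

end
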